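(* Let $n,q\ge 1$, let $G\in\mathbb R^{n\times q}$, and let $Q\in\mathbb R^{q\times q}$ be symmetric positive definite with SVD factors $Q_Q$ (orthogonal) and $D_Q^{1/2}$ (diagonal). Let $t_0=t_{k-1}<t_1<\dots<t_{end}=t_k$ be an integration mesh in the sampling interval $[t_{k-1},t_k]$, with $\tau_l:=t_{l+1}-t_l$ and $t_{l+1/2}:=t_l+\tau_l/2$ for $l=0,1,\dots,end-1$. Let $F(t,x)=\partial_x f(t,x)\in\mathbb R^{n\times n}$ be the Jacobian matrix of the drift function $f:\mathbb R\times\mathbb R^n\to\mathbb R^n$, let $\hat x_{l+1/2}\in\mathbb R^n$ be the given (already computed) mid-point state values, and suppose that the matrices $I_n-\frac{\tau_l}{2}F(t_{l+1/2},\hat x_{l+1/2})$ are invertible. Put $$K_{l+1/2}=\Bigl[I_n-\tfrac{\tau_l}{2}F(t_{l+1/2},\hat x_{l+1/2})\Bigr]^{-1},\qquad M_{l+1/2}=K_{l+1/2}\Bigl[I_n+\tfrac{\tau_l}{2}F(t_{l+1/2},\hat x_{l+1/2})\Bigr].$$ Let $P_{k-1|k-1}\in\mathbb R^{n\times n}$ be the filtered error covariance at time $t_{k-1}$, and define the matrices $P_l$ by $P_0:=P_{k-1|k-1}$ and $$P_{l+1}=M_{l+1/2}P_lM_{l+1/2}^{\top}+\tau_lK_{l+1/2}GQG^{\top}K_{l+1/2}^{\top},\qquad l=0,1,\dots,end-1,$$ with $P_{k|k-1}:=P_{end}$. Suppose SVD factors $Q_{P_{k-1|k-1}}$ (orthogonal)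 and $D^{1/2}_{P_{k-1|k-1}}$ (diagonal) of $P_{k-1|k-1}$ are given, and set $Q_{P_0}:=Q_{P_{k-1|k-1}}$, $D^{1/2}_{P_0}:=D^{1/2}_{P_{k-1|k-1}}$. Given SVD factors $Q_{P_l}$ and $D^{1/2}_{P_l}$ of $P_l$ at the current node $t_l$, define the augmented matrix $$A_{t_l}=\left[M_{l+1/2}Q_{P_l}D_{P_l}^{1/2},\;\;\sqrt{\tau_l}\,K_{l+1/2}GQ_QD_Q^{1/2}\right]\in\mathbb R^{n\times(n+q)}$$ and let $$A_{t_l}=W_{t_l}\,[S_{t_l}\quad 0]\,V_{t_l}^{\top}$$ be a singular value decomposition of $A_{t_l}$. Then $$Q_{P_{l+1}}=W_{t_l},\qquad D^{1/2}_{P_{l+1}}=S_{t_l}$$ are SVD factors of $P_{l+1}$ at the new node $t_{l+1}$. At the last point $t_{end}$ of the mesh, this gives SVD factors $Q_{P_{k|k-1}}:=Q_{P_{end}}$ and $D^{1/2}_{P_{k|k-1}}:=D^{1/2}_{P_{end}}$ of $P_{k|k-1}$.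
   Context: SVD factors: for a symmetric positive (semi-)definite matrix $P$, its SVD (spectral) factors are an orthogonal matrix $Q_P$ and a diagonal matrix $D_P^{1/2}$ with nonnegative diagonal entries such that $P=Q_PD_PQ_P^{\top}$, where $D_P=(D_P^{1/2})^2$ is the diagonal matrix of the singular values of $P$. Error covariance matrices are symmetric positive (semi-)definite. Singular value decomposition of a wide matrix: for $A\in\mathbb R^{n\times(n+q)}$, $A=W\,[S\quad 0]\,V^{\top}$ with $W\in\mathbb R^{n\times n}$ and $V\in\mathbb R^{(n+q)\times(n+q)}$ orthogonal, $S\in\mathbb R^{n\times n}$ diagonal with nonnegative entries (the singular values of $A$), and $0$ the $n\times q$ zero block. $[X,\;Y]$ denotes horizontal concatenation. Setting: the stochastic system is $dx(t)=f(t,x(t))\,dt+G\,d\beta(t)$, where $\beta$ is a $q$-dimensional Brownian motion whose increment has covariance $Q\,dt>0$. The recursion for $P_l$ is the discretized covariance propagation of the extended Kalman filter over one sampling interval. *)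

theory Defs
  imports "HOL-Analysis.Analysis"
begin

definition pos_semidef :: "real^'n^'n \<Rightarrow> bool" where
  "pos_semidef P \<longleftrightarrow> transpose P = P \<and> (\<forall>x. 0 \<le> x \<bullet> (P *v x))"

definition pos_def :: "real^'n^'n \<Rightarrow> bool" where
  "pos_def P \<longleftrightarrow> transpose P = P \<and> (\<forall>x. x \<noteq> 0 \<longrightarrow> 0 < x \<bullet> (P *v x))"

definition nonneg_diagonal :: "real^'n^'n \<Rightarrow> bool" where
  "nonneg_diagonal D \<longleftrightarrow> (\<forall>i j. i \<noteq> j \<longrightarrow> D $ i $ j = 0) \<and> (\<forall>i. 0 \<le> D $ i $ i)"

(* Horizontal concatenation [X, Y].  The columns of an n x (m+k) matrix are indexed by the
   sum type 'm + 'k, which has CARD('m) + CARD('k) elements. *)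
definition hcat :: "'a^'m::finite^'n \<Rightarrow> 'a^'k::finite^'n \<Rightarrow> 'a^('m::finite + 'k::finite)^'n" where
  "hcat X Y = (\<chi> i j. case j of Inl a \<Rightarrow> X $ i $ a | Inr b \<Rightarrow> Y $ i $ b)"

(* The argument Dh is the square root D_P^{1/2} of the diagonal matrix D_P in
   P = Q_P D_P Q_P^T.  The singular values, both here and in wide_svd, are not required to be
   sorted. *)
definition svd_factors :: "real^'n^'n \<Rightarrow> real^'n^'n \<Rightarrow> real^'n^'n \<Rightarrow> bool" where
  "svd_factors P Q Dh \<longleftrightarrow>
     pos_semidef P \<and> orthogonal_matrix Q \<and> nonneg_diagonal Dh \<and>
     P = Q ** (Dh ** Dh) ** transpose Q"

definition wide_svd ::
  "real^('n::finite + 'q::finite)^'n \<Rightarrow> real^'n^'n \<Rightarrow> real^'n^'n \<Rightarrow> real^('n + 'q)^('n + 'q) \<Rightarrow> bool" where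
  "wide_svd A W S V \<longleftrightarrow>
     orthogonal_matrix W \<and> orthogonal_matrix V \<and> nonneg_diagonal S \<and>
     A = W ** hcat S (0 :: real^'q^'n) ** transpose V"

end

theory Submission
  imports Defs
begin

text \<open>The covariance recursion reads \<open>P\<^sub>l\<^sub>+\<^sub>1 = A\<^sub>l A\<^sub>l\<^sup>T\<close>, because the Gram matrix of a horizontal
  concatenation is the sum of the Gram matrices of its blocks. Substituting
  \<open>A\<^sub>l = W [S 0] V\<^sup>T\<close>, the orthogonal factor \<open>V\<close> cancels and \<open>W S\<^sup>2 W\<^sup>T\<close> remains.\<close>

lemma hcat_mult_transpose_hcat:
  fixes X :: "'a::comm_semiring_1^'m^'n" and Y :: "'a^'k^'n"
  shows "hcat X Y ** transpose (hcat X Y) = X ** transpose X + Y ** transpose Y"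
proof -
  \<comment> \<open>The columns of \<open>hcat X Y\<close> are indexed by a sum type, so the sum
    over columns in each entry of the product splits along \<open>Inl\<close> and
    \<open>Inr\<close>, one part per block.\<close>
  have "(\<Sum>j\<in>UNIV. h j) = (\<Sum>a\<in>UNIV. h (Inl a)) + (\<Sum>b\<in>UNIV. h (Inr b))"
    for h :: "'m + 'k \<Rightarrow> 'a"
    using sum.Plus [of "UNIV :: 'm set" "UNIV :: 'k set" h] by simp
  then show ?thesis
    by (simp add: vec_eq_iff matrix_matrix_mult_def transpose_def hcat_def)
qed

text \<open>The quadratic form at \<open>x\<close> is the squared norm of
  \<open>transpose A *v x\<close>. This supplies the \<open>pos_semidef\<close> conjunct in the
  definition of \<open>svd_factors\<close>.\<close>

lemma pos_semidef_mult_transpose: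
  fixes A :: "real^'m^'n"
  shows "pos_semidef (A ** transpose A)"
proof -
  have "x \<bullet> ((A ** transpose A) *v x) = (transpose A *v x) \<bullet> (transpose A *v x)" for x
    by (metis dot_lmul_matrix matrix_vector_mul_assoc transpose_matrix_vector)
  then show ?thesis
    by (simp add: pos_semidef_def matrix_transpose_mul)
qed

lemma transpose_nonneg_diagonal: "nonneg_diagonal D \<Longrightarrow> transpose D = D"
  by (auto simp: nonneg_diagonal_def transpose_def vec_eq_iff) metis

lemma svd_factors_mult_transpose:
  assumes "wide_svd A W S V"
  shows "svd_factors (A ** transpose A) W S"
proof -
  have V: "transpose V ** V = mat 1" and S: "transpose S = S"
    using assms by (auto simp: wide_svd_def orthogonal_matrix_def transpose_nonneg_diagonal)
  let ?B = "hcat S (0 :: real^'b^'a)"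
  \<comment> \<open>The bracketing isolates \<open>transpose V ** V\<close>, which then collapses to
    \<open>mat 1\<close>.\<close>
  have "A ** transpose A = W ** (?B ** (transpose V ** V) ** transpose ?B) ** transpose W"
    using assms by (simp add: wide_svd_def matrix_transpose_mul matrix_mul_assoc)
  \<comment> \<open>The zero block contributes nothing to the Gram matrix of \<open>?B\<close>, and
    symmetry of \<open>S\<close> turns \<open>S ** transpose S\<close> into
    \<open>S ** S\<close>.\<close>
  also have "\<dots> = W ** (S ** S) ** transpose W"
    by (simp add: V S hcat_mult_transpose_hcat)
  finally show ?thesis
    using assms pos_semidef_mult_transpose [of A] by (simp add: svd_factors_def wide_svd_def)
qed

text \<open>\<open>Q ** Dh\<close> acts as a matrix square root of \<open>P\<close>, since the
  diagonal \<open>Dh\<close> is its own transpose. Both blocks of the augmented matrix have this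
  form: one comes from the covariance, the other from the noise.\<close>

lemma congruence_by_svd_factors:
  assumes "svd_factors P Q Dh"
  shows "(B ** Q ** Dh) ** transpose (B ** Q ** Dh) = B ** P ** transpose B"
proof -
  have P: "P = Q ** (Dh ** Dh) ** transpose Q" and Dh: "transpose Dh = Dh"
    using assms by (auto simp: svd_factors_def transpose_nonneg_diagonal)
  show ?thesis
    by (subst P) (simp add: Dh matrix_transpose_mul matrix_mul_assoc)
qed

text \<open>One mesh step in abstract form, with \<open>c\<close> in the role of the step size and
  \<open>L\<close> in that of \<open>K l ** G\<close>.\<close>

lemma svd_factors_propagate:
  assumes "svd_factors P Q_P Dh_P" "svd_factors Q Q_Q Dh_Q" "0 \<le> c"
    and "wide_svd (hcat (M ** Q_P ** Dh_P) (sqrt c *\<^sub>R (L ** Q_Q ** Dh_Q))) W S V"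
  shows "svd_factors (M ** P ** transpose M + c *\<^sub>R (L ** Q ** transpose L)) W S"
proof -
  \<comment> \<open>The factor \<open>sqrt c\<close> occurs twice in the Gram matrix;
    \<open>0 \<le> c\<close> makes its square equal to \<open>c\<close>.\<close>
  have "(sqrt c *\<^sub>R B) ** transpose (sqrt c *\<^sub>R B) = c *\<^sub>R (B ** transpose B)"
    for B :: "real^'b^'a"
    using \<open>0 \<le> c\<close>
    by (simp add: transpose_scalar matrix_scalar_ac scalar_matrix_assoc [symmetric])
  then show ?thesis
    using svd_factors_mult_transpose [OF assms(4)]
    by (simp add: hcat_mult_transpose_hcat congruence_by_svd_factors [OF assms(1)]
        congruence_by_svd_factors [OF assms(2)])
qed

theorem lemma1:
  fixes G :: "real^'q^'n"
    and Q Q_Q Dh_Q :: "real^'q^'q"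
    and f :: "real \<Rightarrow> real^'n \<Rightarrow> real^'n"
    and F :: "real \<Rightarrow> real^'n \<Rightarrow> real^'n^'n"
    and t \<tau> t_mid :: "nat \<Rightarrow> real"
    and t_prev t_cur :: real
    and N :: nat
    and x_mid :: "nat \<Rightarrow> real^'n"
    and K M P :: "nat \<Rightarrow> real^'n^'n"
    and P_filt P_pred Q_filt Dh_filt :: "real^'n^'n"
    and A :: "nat \<Rightarrow> real^'n^'n \<Rightarrow> real^'n^'n \<Rightarrow> real^('n + 'q)^'n"
  assumes Q: "pos_def Q" "svd_factors Q Q_Q Dh_Q"
    and mesh: "1 \<le> N" "t 0 = t_prev" "t N = t_cur" "\<And>l. l < N \<Longrightarrow> t l < t (Suc l)"
    and \<tau>: "\<And>l. l < N \<Longrightarrow> \<tau> l = t (Suc l) - t l"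
    and t_mid: "\<And>l. l < N \<Longrightarrow> t_mid l = t l + \<tau> l / 2"
    and f: "\<And>s x. f s differentiable (at x)"
    and F: "\<And>s x. F s x = jacobian (f s) (at x)"
    and inv: "\<And>l. l < N \<Longrightarrow> invertible (mat 1 - (\<tau> l / 2) *\<^sub>R F (t_mid l) (x_mid l))"
    and K: "\<And>l. l < N \<Longrightarrow> K l = matrix_inv (mat 1 - (\<tau> l / 2) *\<^sub>R F (t_mid l) (x_mid l))"
    and M: "\<And>l. l < N \<Longrightarrow> M l = K l ** (mat 1 + (\<tau> l / 2) *\<^sub>R F (t_mid l) (x_mid l))"
    and P_filt: "pos_semidef P_filt" "svd_factors P_filt Q_filt Dh_filt"
    and P_0: "P 0 = P_filt"
    and P_Suc: "\<And>l. l < N \<Longrightarrow> P (Suc l) = M l ** P l ** transpose (M l)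
                  + \<tau> l *\<^sub>R (K l ** G ** Q ** transpose G ** transpose (K l))"
    and P_pred: "P_pred = P N"
    and A: "\<And>l Q_P Dh_P. l < N \<Longrightarrow>
              A l Q_P Dh_P = hcat (M l ** Q_P ** Dh_P) (sqrt (\<tau> l) *\<^sub>R (K l ** G ** Q_Q ** Dh_Q))"
  shows "(\<forall>l<N. \<forall>Q_P Dh_P W S V.
            svd_factors (P l) Q_P Dh_P \<and> wide_svd (A l Q_P Dh_P) W S V \<longrightarrow>
            svd_factors (P (Suc l)) W S) \<and>
         (\<forall>Q_P Dh_P W S V.
            Q_P 0 = Q_filt \<and> Dh_P 0 = Dh_filt \<and>
            (\<forall>l<N. wide_svd (A l (Q_P l) (Dh_P l)) (W l) (S l) (V l) \<and>
                   Q_P (Suc l) = W l \<and> Dh_P (Suc l) = S l) \<longrightarrow>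
            (\<forall>l\<le>N. svd_factors (P l) (Q_P l) (Dh_P l)) \<and>
            svd_factors P_pred (Q_P N) (Dh_P N))"
proof -
  have step: "svd_factors (P (Suc l)) W S"
    if "l < N" "svd_factors (P l) Q_P Dh_P" "wide_svd (A l Q_P Dh_P) W S V" for l Q_P Dh_P W S V
  proof -
    \<comment> \<open>The mesh is strictly increasing, so its step sizes are positive.\<close>
    have "0 \<le> \<tau> l"
      using mesh(4) \<tau> \<open>l < N\<close> by (simp add: less_imp_le)
    then show ?thesis
      using svd_factors_propagate [OF that(2) Q(2), of "\<tau> l" "M l" "K l ** G"] that
      by (simp add: A P_Suc matrix_transpose_mul matrix_mul_assoc)
  qed
  \<comment> \<open>Induction along the mesh: the factors start from those of \<open>P_filt\<close>,
    and \<open>Suc l \<le> N\<close> gives the bound \<open>l < N\<close> under which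
    \<open>step\<close> applies. The case \<open>l = N\<close> yields the factors of
    \<open>P_pred\<close>.\<close>
  have "svd_factors (P l) (Q_P l) (Dh_P l)"
    if "Q_P 0 = Q_filt" "Dh_P 0 = Dh_filt" "l \<le> N"
      "\<forall>l<N. wide_svd (A l (Q_P l) (Dh_P l)) (W l) (S l) (V l) \<and>
             Q_P (Suc l) = W l \<and> Dh_P (Suc l) = S l" for Q_P Dh_P W S V l
    using \<open>l \<le> N\<close>
  proof (induction l)
    case 0
    then show ?case
      using that P_filt(2) P_0 by simp
  next
    case (Suc l)
    then show ?case
      using that(4) step by (metis Suc_leD Suc_le_lessD)
  qed
  then show ?thesis
    using step P_pred by blast
qed

end
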